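(* Consider an extensive-form game with player set $P$, chance player $p_c$, set of states $S$, set of terminal states $Z$, and behaviour strategies $\sigma_q$ for all $q\in P\cup\{p_c\}$. Let $P_a\subseteq P\cup\{p_c\}$ be a non-empty set of players, including $p_c$, whose strategies are known, and let $P_o=P\setminus P_a$. Let $\mathcal{H}$ be an admissible partition of the states $h$ with $p(h)\in P_a$, let $\mathcal{W}$ be a partition of $Z$ matching $\mathcal{H}$, and let $u_h:A'(h)\to\mathbb{R}$ be arbitrary functions, one for each state $h$ with $p(h)\in P_a$. Fix a player $p\in P$ with value function $v_p:Z\to\mathbb{R}$, and for an observed terminal state $z\in W\in\mathcal{W}$ define $$\mathrm{AIVAT}(z)=\frac{\sum_{z'\in W}\pi_{P_a}(z')\,v_p(z')}{\sum_{z'\in W}\pi_{P_a}(z')}+\sum_{H\in\mathcal{H}}k_H(z),$$ where $k_H$ is the correction term of the part $H$. Then $\mathrm{AIVAT}$ is an unbiased estimator of the expected value for player $p$, i.e. $\mathbb{E}_z[\mathrm{AIVAT}(z)]=\mathbb{E}_z[v_p(z)]$: $$\sum_{z\in Z}\pi(z)\,\mathrm{AIVAT}(z)=\sum_{z\in Z}\pi(z)\,v_p(z).$$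
   Context: **Game.** An extensive-form game consists of a set of players $P$ and a chance player $p_c$; a set $S$ of states, each described as a history of actions from the initial state $\varnothing$; a set $Z\subset S$ of terminal states; an acting-player function $p(\cdot):S\setminus Z\to P\cup\{p_c\}$; player value functions $v_q:Z\to\mathbb{R}$; and information partitions $\mathcal{I}_q$ of $\{h\in S: p(h)=q\}$. Write $h\sqsubset h'$ if a game in state $h'$ was previously in state $h$, and $h\sqsubseteq h'$ if $h\sqsubset h'$ or $h=h'$. $A(h)$ is the set of valid actions at $h$, and $h\cdot a$ is the successor state of $h$ reached by making action $a$. **Strategies and reach probabilities.** A behaviour strategy $\sigma_q(I,a)$ gives the probability of player $q$ choosing $a$ at information set $I\in\mathcal{I}_q$; $\sigma_q(h,a)=\sigma_q(I,a)$ for all $h\in I$. For states $h$ with $p(h)=p_c$, $\sigma_{p_c}(h,\cdot)$ is the publicly known probability distribution over chance outcomes at $h$. Put $\pi(h)=\prod_{h'\cdot a\sqsubseteq h}\sigma_{p(h')}(h',a)$ (the probability of reaching $h$), $\pi_q(h)=\prod_{h'\cdot a\sqsubseteq h,\ p(h')=q}\sigma_q(h',a)$, and $\pi_T(h)=\prod_{q\in T}\pi_q(h)$ for any set of players $T$. For a function $f$ on $Z$, $\mathbb{E}_z[f(z)]=\sum_{z\in Z}\pi(z)f(z)$. **Admissible partition $\mathcal{H}$.** A partition $\mathcal{H}$ of $\{h: p(h)\in P_a\}$ is called admissible here if for every $H\in\mathcal{H}$ and all $h,h'\in H$: (1) for every $q\in P_o$ and every $\sigma_q$, $\pi_q(h)=\pi_q(h')$;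 (2) $h\not\sqsubset h'$ (so for any terminal $z$, the set $\{h''\in H: h''\sqsubset z\}$ is empty or a singleton); (3) the actions are extended so that $A'(h)=\bigcup_{h''\in H}A(h'')$, with $\sigma(h,a)=0$ for all $a\in A'(h)\setminus A(h)$; since $A'(h)=A'(h')$, write $A(H)=A'(h)$. (Thus $\pi_{P_a}(h\cdot a)=\pi_{P_a}(h)\,\sigma_{p(h)}(h,a)$, which is $0$ for $a\in A(H)\setminus A(h)$.) **Correction term $k_H$.** Given $z\in Z$ and $H\in\mathcal{H}$: if there is no $h\in H$ with $h\sqsubset z$, then $k_H(z)=0$. Otherwise, by (2), there is a unique observed action $a_{\mathrm{O}}$ such that $\bar h\cdot a_{\mathrm{O}}\sqsubseteq z$ for some $\bar h\in H$ with $a_{\mathrm{O}}\in A(\bar h)$, and $$k_H(z)=\frac{\sum_{a\in A(H)}\sum_{h\in H}\pi_{P_a}(h\cdot a)u_h(a)}{\sum_{h\in H}\pi_{P_a}(h)}-\frac{\sum_{h\in H}\pi_{P_a}(h\cdot a_{\mathrm{O}})u_h(a_{\mathrm{O}})}{\sum_{h\in H}\pi_{P_a}(h\cdot a_{\mathrm{O}})}.$$ **Matching partition $\mathcal{W}$.** A partition $\mathcal{W}$ of $Z$ matches $\mathcal{H}$ if for every $W\in\mathcal{W}$ and all $z,z'\in W$: (i) for every $q\in P_o$ and every $\sigma_q$, $\pi_q(z)=\pi_q(z')$; (ii) a player in $P_a$ made an action in $z$ if and only if a player in $P_a$ made an action in $z'$; (iii) if a player in $P_a$ made an action in $z$, then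 for the longest prefixes $h\sqsubset z$ and $h'\sqsubset z'$ such that $p(h)\in P_a$ and $p(h')\in P_a$, both $h$ and $h'$ are in the same part of $\mathcal{H}$. *)

theory Defs
  imports Complex_Main "HOL-Library.Sublist" "HOL-Library.Disjoint_Sets"
begin

section \<open>Extensive-form games\<close>

text \<open>A state is the list of actions leading to it from the initial state \<open>[]\<close>, so that
  \<open>h \<sqsubseteq> h'\<close> is \<^const>\<open>prefix\<close>, \<open>h \<sqsubset> h'\<close> is \<^const>\<open>strict_prefix\<close> and
  \<open>h \<cdot> a\<close> is \<open>h @ [a]\<close>.\<close>

record ('a, 'p) efg =
  players :: "'p set"
  chance :: 'p
  states :: "'a list set"
  terminals :: "'a list set"
  actor :: "'a list \<Rightarrow> 'p"
  payoff :: "'p \<Rightarrow> 'a list \<Rightarrow> real"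
  infosets :: "'p \<Rightarrow> 'a list set set"
  chance_prob :: "'a list \<Rightarrow> 'a \<Rightarrow> real"

definition actions :: "('a, 'p) efg \<Rightarrow> 'a list \<Rightarrow> 'a set" where
  "actions G h = {a. h @ [a] \<in> states G}"

definition decision_states :: "('a, 'p) efg \<Rightarrow> 'p set \<Rightarrow> 'a list set" where
  "decision_states G T = {h \<in> states G - terminals G. actor G h \<in> T}"

definition distribution_on :: "'a set \<Rightarrow> ('a \<Rightarrow> real) \<Rightarrow> bool" where
  "distribution_on A f \<longleftrightarrow> (\<forall>a\<in>A. 0 \<le> f a) \<and> (\<Sum>a\<in>A. f a) = 1"

text \<open>Games are finite, so that all sums below are genuine.\<close>

definition extensive_game :: "('a, 'p) efg \<Rightarrow> bool" where
  "extensive_game G \<longleftrightarrow>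
     finite (players G) \<and> chance G \<notin> players G \<and>
     finite (states G) \<and> [] \<in> states G \<and>
     (\<forall>h a. h @ [a] \<in> states G \<longrightarrow> h \<in> states G) \<and>
     terminals G \<subseteq> states G \<and>
     (\<forall>h\<in>states G. h \<in> terminals G \<longleftrightarrow> actions G h = {}) \<and>
     (\<forall>h\<in>states G - terminals G. actor G h \<in> players G \<union> {chance G}) \<and>
     (\<forall>q\<in>players G. partition_on (decision_states G {q}) (infosets G q)) \<and>
     (\<forall>h\<in>decision_states G {chance G}. distribution_on (actions G h) (chance_prob G h))"


section \<open>Strategies and reach probabilities\<close>

definition part_of :: "'b set set \<Rightarrow> 'b \<Rightarrow> 'b set" where
  "part_of \<P> x = (THE X. X \<in> \<P> \<and> x \<in> X)"

text \<open>Usually \<^const>\<open>actions\<close> is constant on each information set. This need not be assumed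
  here: the strategy at an information set must be a distribution on the valid actions of each of
  its states.\<close>

definition behaviour_strategy ::
  "('a, 'p) efg \<Rightarrow> 'p \<Rightarrow> ('a list set \<Rightarrow> 'a \<Rightarrow> real) \<Rightarrow> bool" where
  "behaviour_strategy G q s \<longleftrightarrow>
     (\<forall>I\<in>infosets G q. \<forall>h\<in>I. distribution_on (actions G h) (s I))"

text \<open>The probability \<open>\<sigma>\<^bsub>p(h)\<^esub>(h, a)\<close>, extended by \<open>0\<close> to actions that are not valid at \<open>h\<close>.\<close>

definition action_prob ::
  "('a, 'p) efg \<Rightarrow> ('p \<Rightarrow> 'a list set \<Rightarrow> 'a \<Rightarrow> real) \<Rightarrow> 'a list \<Rightarrow> 'a \<Rightarrow> real" where
  "action_prob G \<sigma> h a =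
     (if a \<notin> actions G h then 0
      else if actor G h = chance G then chance_prob G h a
      else \<sigma> (actor G h) (part_of (infosets G (actor G h)) h) a)"

definition reach ::
  "('a, 'p) efg \<Rightarrow> ('p \<Rightarrow> 'a list set \<Rightarrow> 'a \<Rightarrow> real) \<Rightarrow> 'a list \<Rightarrow> real" where
  "reach G \<sigma> h = (\<Prod>(h', a)\<in>{(h', a). prefix (h' @ [a]) h}. action_prob G \<sigma> h' a)"

text \<open>Only the component \<open>\<sigma> q\<close> of the profile matters for \<open>player_reach G \<sigma> q\<close>.\<close>

definition player_reach ::
  "('a, 'p) efg \<Rightarrow> ('p \<Rightarrow> 'a list set \<Rightarrow> 'a \<Rightarrow> real) \<Rightarrow> 'p \<Rightarrow> 'a list \<Rightarrow> real" where
  "player_reach G \<sigma> q h =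
     (\<Prod>(h', a)\<in>{(h', a). prefix (h' @ [a]) h \<and> actor G h' = q}. action_prob G \<sigma> h' a)"

definition team_reach ::
  "('a, 'p) efg \<Rightarrow> ('p \<Rightarrow> 'a list set \<Rightarrow> 'a \<Rightarrow> real) \<Rightarrow> 'p set \<Rightarrow> 'a list \<Rightarrow> real" where
  "team_reach G \<sigma> T h = (\<Prod>q\<in>T. player_reach G \<sigma> q h)"


section \<open>Admissible and matching partitions\<close>

text \<open>Throughout, \<open>Pa\<close> is the set of players (including chance) with known strategies;
  the other players are \<open>players G - Pa\<close>.\<close>

definition same_opponent_reach ::
  "('a, 'p) efg \<Rightarrow> 'p set \<Rightarrow> 'a list \<Rightarrow> 'a list \<Rightarrow> bool" where
  "same_opponent_reach G Pa h h' \<longleftrightarrow>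
     (\<forall>q\<in>players G - Pa. \<forall>\<sigma>. behaviour_strategy G q (\<sigma> q) \<longrightarrow>
        player_reach G \<sigma> q h = player_reach G \<sigma> q h')"

definition admissible_partition ::
  "('a, 'p) efg \<Rightarrow> 'p set \<Rightarrow> 'a list set set \<Rightarrow> bool" where
  "admissible_partition G Pa \<H> \<longleftrightarrow>
     partition_on (decision_states G Pa) \<H> \<and>
     (\<forall>H\<in>\<H>. \<forall>h\<in>H. \<forall>h'\<in>H. same_opponent_reach G Pa h h' \<and> \<not> strict_prefix h h')"

definition team_acted :: "('a, 'p) efg \<Rightarrow> 'p set \<Rightarrow> 'a list \<Rightarrow> bool" where
  "team_acted G Pa z \<longleftrightarrow> (\<exists>h. strict_prefix h z \<and> actor G h \<in> Pa)"

definition last_team_state :: "('a, 'p) efg \<Rightarrow> 'p set \<Rightarrow> 'a list \<Rightarrow> 'a list \<Rightarrow> bool" where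
  "last_team_state G Pa z h \<longleftrightarrow>
     strict_prefix h z \<and> actor G h \<in> Pa \<and>
     (\<forall>h'. strict_prefix h' z \<and> actor G h' \<in> Pa \<longrightarrow> length h' \<le> length h)"

definition matching_partition ::
  "('a, 'p) efg \<Rightarrow> 'p set \<Rightarrow> 'a list set set \<Rightarrow> 'a list set set \<Rightarrow> bool" where
  "matching_partition G Pa \<H> \<W> \<longleftrightarrow>
     partition_on (terminals G) \<W> \<and>
     (\<forall>W\<in>\<W>. \<forall>z\<in>W. \<forall>z'\<in>W.
        same_opponent_reach G Pa z z' \<and>
        (team_acted G Pa z \<longleftrightarrow> team_acted G Pa z') \<and>
        (team_acted G Pa z \<longrightarrow>
           (\<forall>h h'. last_team_state G Pa z h \<and> last_team_state G Pa z' h' \<longrightarrow>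
              (\<exists>H\<in>\<H>. h \<in> H \<and> h' \<in> H))))"


section \<open>The AIVAT estimator\<close>

definition part_actions :: "('a, 'p) efg \<Rightarrow> 'a list set \<Rightarrow> 'a set" where
  "part_actions G H = (\<Union>h\<in>H. actions G h)"

definition observed_action :: "('a, 'p) efg \<Rightarrow> 'a list set \<Rightarrow> 'a list \<Rightarrow> 'a" where
  "observed_action G H z = (THE a. \<exists>h\<in>H. a \<in> actions G h \<and> prefix (h @ [a]) z)"

definition correction ::
  "('a, 'p) efg \<Rightarrow> ('p \<Rightarrow> 'a list set \<Rightarrow> 'a \<Rightarrow> real) \<Rightarrow> 'p set \<Rightarrow>
   ('a list \<Rightarrow> 'a \<Rightarrow> real) \<Rightarrow> 'a list set \<Rightarrow> 'a list \<Rightarrow> real" where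
  "correction G \<sigma> Pa u H z =
     (if \<not> (\<exists>h\<in>H. strict_prefix h z) then 0
      else let aO = observed_action G H z in
        (\<Sum>a\<in>part_actions G H. \<Sum>h\<in>H. team_reach G \<sigma> Pa (h @ [a]) * u h a) /
        (\<Sum>h\<in>H. team_reach G \<sigma> Pa h)
        - (\<Sum>h\<in>H. team_reach G \<sigma> Pa (h @ [aO]) * u h aO) /
          (\<Sum>h\<in>H. team_reach G \<sigma> Pa (h @ [aO])))"

text \<open>A denominator can vanish, making a quotient \<open>0\<close> by convention, only at a terminal state of
  reach probability \<open>0\<close>.\<close>

definition aivat ::
  "('a, 'p) efg \<Rightarrow> ('p \<Rightarrow> 'a list set \<Rightarrow> 'a \<Rightarrow> real) \<Rightarrow> 'p set \<Rightarrow>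
   'a list set set \<Rightarrow> 'a list set set \<Rightarrow> ('a list \<Rightarrow> 'a \<Rightarrow> real) \<Rightarrow> 'p \<Rightarrow> 'a list \<Rightarrow> real" where
  "aivat G \<sigma> Pa \<H> \<W> u p z =
     (\<Sum>z'\<in>part_of \<W> z. team_reach G \<sigma> Pa z' * payoff G p z') /
     (\<Sum>z'\<in>part_of \<W> z. team_reach G \<sigma> Pa z')
     + (\<Sum>H\<in>\<H>. correction G \<sigma> Pa u H z)"

end

(* Split the reach probability as \<pi> = \<pi>_Pa * \<pi>_Po. The opponents' factor is constant on each part of
   \<W>, so the quotient in AIVAT is the conditional expectation of the payoff given W, and averaging it
   changes nothing. It is also constant on each part H of \<H>; hence, after summing over all terminal
   states that pass through a given h \<cdot> a, the expectation of k_H becomes the constant \<pi>_Po(H) times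
   a telescoping expression in \<pi>_Pa alone. *)

theory Submission
  imports Defs
begin

section \<open>Sums over partitions and weighted averages\<close>

lemma sum_partition_on:
  assumes "finite A" "partition_on A P"
  shows "sum f A = (\<Sum>X\<in>P. sum f X)"
proof -
  have "sum f (\<Union>P) = (\<Sum>X\<in>P. sum f X)"
    using assms by (subst sum.Union_disjoint)
      (auto simp: partition_on_def disjoint_def intro: finite_subset)
  then show ?thesis using assms(2) by (simp add: partition_on_def)
qed

lemma part_of_eq:
  assumes "partition_on A P" "X \<in> P" "x \<in> X"
  shows "part_of P x = X"
  unfolding part_of_def using assms by (intro the_equality) (auto simp: partition_on_def disjoint_def)

lemma part_of_in:
  assumes "partition_on A P" "x \<in> A"
  shows "part_of P x \<in> P" "x \<in> part_of P x"
proof -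
  obtain X where "X \<in> P" "x \<in> X" using assms by (auto simp: partition_on_def)
  then show "part_of P x \<in> P" "x \<in> part_of P x" using part_of_eq[OF assms(1)] by auto
qed

text \<open>If the total weight is zero, nonnegativity makes every weight zero, so the identity
  survives division by zero. It lets the quotients in \<open>aivat\<close> and
  \<open>correction\<close> be cancelled without assuming positive reach probabilities.\<close>

lemma sum_weighted_average:
  fixes m :: "'b \<Rightarrow> real"
  assumes "finite A" "\<And>x. x \<in> A \<Longrightarrow> 0 \<le> m x"
  shows "(\<Sum>x\<in>A. m x) * ((\<Sum>x\<in>A. m x * f x) / (\<Sum>x\<in>A. m x)) = (\<Sum>x\<in>A. m x * f x)"
proof (cases "(\<Sum>x\<in>A. m x) = 0")
  case True
  then have "\<forall>x\<in>A. m x = 0" using assms by (simp add: sum_nonneg_eq_0_iff)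
  then show ?thesis by simp
qed simp

section \<open>Reach probabilities, one action at a time\<close>

lemma finite_prefix_steps: "finite {(h', a). prefix (h' @ [a]) h \<and> Q h'}"
proof (rule finite_subset)
  \<comment> \<open>A step is recovered from the nonempty prefix \<open>h' @ [a]\<close> by cutting
    off its last letter, and a list has finitely many prefixes.\<close>
  show "{(h', a). prefix (h' @ [a]) h \<and> Q h'} \<subseteq> (\<lambda>k. (butlast k, last k)) ` {k. prefix k h}"
    by (force intro: image_eqI[where x = "_ @ [_]"])
  show "finite ((\<lambda>k. (butlast k, last k)) ` {k. prefix k h})"
    by (metis finite_imageI finite_set set_prefixes_eq)
qed

lemma reach_snoc: "reach G \<sigma> (h @ [a]) = reach G \<sigma> h * action_prob G \<sigma> h a"
proof -
  have "{(h', b). prefix (h' @ [b]) (h @ [a])} = insert (h, a) {(h', b). prefix (h' @ [b]) h}"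
    by auto
  moreover have "(h, a) \<notin> {(h', b). prefix (h' @ [b]) h}"
    by (auto dest: prefix_length_le)
  ultimately show ?thesis
    using finite_prefix_steps[of h "\<lambda>_. True"] by (simp add: reach_def)
qed

lemma player_reach_snoc:
  "player_reach G \<sigma> q (h @ [a]) =
     player_reach G \<sigma> q h * (if actor G h = q then action_prob G \<sigma> h a else 1)"
proof -
  have "{(h', b). prefix (h' @ [b]) (h @ [a]) \<and> actor G h' = q} =
      (if actor G h = q then insert (h, a) {(h', b). prefix (h' @ [b]) h \<and> actor G h' = q}
       else {(h', b). prefix (h' @ [b]) h \<and> actor G h' = q})"
    by auto
  moreover have "(h, a) \<notin> {(h', b). prefix (h' @ [b]) h \<and> actor G h' = q}"
    by (auto dest: prefix_length_le)
  ultimately show ?thesis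
    using finite_prefix_steps[of h "\<lambda>h'. actor G h' = q"] by (simp add: player_reach_def)
qed

text \<open>One player acts at \<open>h\<close>, so at most one factor of the product over
  \<open>T\<close> changes; \<open>prod.delta\<close> picks it out.\<close>

lemma team_reach_snoc:
  assumes "finite T"
  shows "team_reach G \<sigma> T (h @ [a]) =
     team_reach G \<sigma> T h * (if actor G h \<in> T then action_prob G \<sigma> h a else 1)"
  using assms by (simp add: team_reach_def player_reach_snoc prod.distrib prod.delta)

lemma reach_Nil: "reach G \<sigma> [] = 1"
  by (simp add: reach_def)

lemma team_reach_Nil: "team_reach G \<sigma> T [] = 1"
  by (simp add: team_reach_def player_reach_def)

text \<open>Two members of \<open>H\<close> that are prefixes of the same \<open>z\<close> are
  comparable, hence equal because \<open>H\<close> is an antichain; the letter of \<open>z\<close>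
  after them is then determined.\<close>

lemma observed_action_eq:
  assumes "\<And>h h'. h \<in> H \<Longrightarrow> h' \<in> H \<Longrightarrow> \<not> strict_prefix h h'"
    and "h \<in> H" "a \<in> actions G h" "prefix (h @ [a]) z"
  shows "observed_action G H z = a"
  unfolding observed_action_def
proof (rule the_equality)
  show "\<exists>h\<in>H. a \<in> actions G h \<and> prefix (h @ [a]) z" using assms by blast
next
  fix b assume "\<exists>h\<in>H. b \<in> actions G h \<and> prefix (h @ [b]) z"
  then obtain h' where h': "h' \<in> H" "prefix (h' @ [b]) z" by blast
  have "prefix h z" "prefix h' z" using h'(2) assms(4) by (auto dest: append_prefixD)
  then have "h = h'"
    using prefix_same_cases assms(1)[OF assms(2) h'(1)] assms(1)[OF h'(1) assms(2)]
    by (metis strict_prefix_def)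
  then show "b = a"
    using h'(2) assms(4) by (auto simp: prefix_def)
qed

section \<open>Finite games played with behaviour strategies\<close>

locale played_game =
  fixes G :: "('a, 'p) efg" and \<sigma> :: "'p \<Rightarrow> 'a list set \<Rightarrow> 'a \<Rightarrow> real"
  assumes game: "extensive_game G"
    and strategies: "\<And>q. q \<in> players G \<Longrightarrow> behaviour_strategy G q (\<sigma> q)"
begin

lemma finite_states: "finite (states G)"
  and finite_players: "finite (players G)"
  and terminals_subset: "terminals G \<subseteq> states G"
  and states_snocD: "h @ [a] \<in> states G \<Longrightarrow> h \<in> states G"
  and terminal_iff: "h \<in> states G \<Longrightarrow> h \<in> terminals G \<longleftrightarrow> actions G h = {}"
  and actor_in: "h \<in> states G - terminals G \<Longrightarrow> actor G h \<in> players G \<union> {chance G}"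
  using game by (auto simp: extensive_game_def)

lemma finite_terminals: "finite (terminals G)"
  using finite_states terminals_subset finite_subset by blast

lemma finite_actions: "finite (actions G h)"
proof (rule finite_surj)
  show "finite (states G)" by (rule finite_states)
  show "actions G h \<subseteq> last ` states G"
    by (force simp: actions_def intro: image_eqI[where x = "h @ [_]"])
qed

lemma states_prefix_closed:
  assumes "h' \<in> states G" "prefix h h'"
  shows "h \<in> states G"
  using assms by (induction h' rule: rev_induct) (auto dest: states_snocD)

lemma strict_prefix_step:
  assumes "z \<in> states G" "strict_prefix h z"
  obtains a where "a \<in> actions G h" "prefix (h @ [a]) z"
proof -
  obtain a zs where z: "z = h @ a # zs"
    using assms(2) by (rule strict_prefixE')
  then have "prefix (h @ [a]) z" by simp
  moreover from this have "a \<in> actions G h"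
    using states_prefix_closed assms(1) by (auto simp: actions_def)
  ultimately show ?thesis using that by blast
qed

lemma action_prob_distribution:
  assumes "h \<in> states G - terminals G"
  shows "distribution_on (actions G h) (action_prob G \<sigma> h)"
proof -
  \<comment> \<open>\<open>f\<close> omits the default value 0 outside \<open>actions G h\<close>;
    it agrees with \<open>action_prob\<close> on the valid actions, which is all that
    \<open>distribution_on\<close> sees.\<close>
  define f where "f = (if actor G h = chance G then chance_prob G h
    else \<sigma> (actor G h) (part_of (infosets G (actor G h)) h))"
  have "distribution_on (actions G h) f"
  proof (cases "actor G h = chance G")
    case True
    then show ?thesis
      using game assms by (auto simp: f_def extensive_game_def decision_states_def)
  next
    case False
    then have q: "actor G h \<in> players G" using actor_in assms by blast
    then have "partition_on (decision_states G {actor G h}) (infosets G (actor G h))"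
      using game by (auto simp: extensive_game_def)
    moreover have "h \<in> decision_states G {actor G h}"
      using assms by (simp add: decision_states_def)
    ultimately show ?thesis
      using part_of_in[of _ "infosets G (actor G h)" h] strategies[OF q] False
      by (auto simp: f_def behaviour_strategy_def)
  qed
  moreover have "action_prob G \<sigma> h a = f a" if "a \<in> actions G h" for a
    using that by (simp add: f_def action_prob_def)
  ultimately show ?thesis
    by (simp add: distribution_on_def)
qed

lemma action_prob_nonneg: "h \<in> states G - terminals G \<Longrightarrow> 0 \<le> action_prob G \<sigma> h a"
  using action_prob_distribution by (cases "a \<in> actions G h")
    (auto simp: distribution_on_def action_prob_def)

text \<open>\<open>A\<close> may exceed the valid actions because the corrections use the joint set
  \<open>part_actions\<close>; \<open>action_prob\<close> is 0 on the surplus.\<close>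

lemma sum_action_prob:
  assumes "h \<in> states G - terminals G" "actions G h \<subseteq> A" "finite A"
  shows "(\<Sum>a\<in>A. action_prob G \<sigma> h a) = 1"
proof -
  have "(\<Sum>a\<in>A. action_prob G \<sigma> h a) = (\<Sum>a\<in>actions G h. action_prob G \<sigma> h a)"
    using assms by (intro sum.mono_neutral_right) (auto simp: action_prob_def)
  then show ?thesis using action_prob_distribution[OF assms(1)] by (simp add: distribution_on_def)
qed

lemma snoc_state_nonterminal:
  assumes "h @ [a] \<in> states G"
  shows "h \<in> states G - terminals G"
  using assms states_snocD terminal_iff by (fastforce simp: actions_def)

lemma team_reach_nonneg:
  assumes "finite T" "h \<in> states G"
  shows "0 \<le> team_reach G \<sigma> T h"
  using assms(2)
proof (induction h rule: rev_induct)
  case (snoc a h)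
  then show ?case
    using snoc_state_nonterminal[of h a] action_prob_nonneg[of h a] assms(1)
    by (simp add: team_reach_snoc)
qed (simp add: team_reach_Nil)

text \<open>Exactly one of the two teams owns the actor at each nonterminal state, so every action
  contributes its probability to one factor and 1 to the other.\<close>

lemma reach_eq_team_reach_mult:
  assumes "finite T" "finite T'" "T \<inter> T' = {}" "T \<union> T' = players G \<union> {chance G}"
    and "h \<in> states G"
  shows "reach G \<sigma> h = team_reach G \<sigma> T h * team_reach G \<sigma> T' h"
  using assms(5)
proof (induction h rule: rev_induct)
  case (snoc a h)
  have "actor G h \<in> T \<union> T'"
    using snoc_state_nonterminal[OF snoc.prems] actor_in assms(4) by blast
  then have "(if actor G h \<in> T then action_prob G \<sigma> h a else 1) *
      (if actor G h \<in> T' then action_prob G \<sigma> h a else 1) = action_prob G \<sigma> h a"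
    using assms(3) by auto
  then show ?case
    using snoc states_snocD[OF snoc.prems] assms(1,2)
    by (simp add: reach_snoc team_reach_snoc mult.assoc mult.left_commute)
qed (simp add: reach_Nil team_reach_Nil)

section \<open>Summation over terminal states\<close>

lemma sum_terminals_strict_prefix:
  "(\<Sum>z | z \<in> terminals G \<and> strict_prefix h z. f z) =
   (\<Sum>a\<in>actions G h. \<Sum>z | z \<in> terminals G \<and> prefix (h @ [a]) z. f z)"
proof -
  have "{z. z \<in> terminals G \<and> strict_prefix h z} =
      (\<Union>a\<in>actions G h. {z. z \<in> terminals G \<and> prefix (h @ [a]) z})"
    (is "?L = ?R")
  proof
    show "?L \<subseteq> ?R" using terminals_subset by (auto elim: strict_prefix_step[rotated])
    show "?R \<subseteq> ?L" by (auto simp: prefix_def strict_prefix_def)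
  qed
  also have "sum f \<dots> = (\<Sum>a\<in>actions G h. \<Sum>z | z \<in> terminals G \<and> prefix (h @ [a]) z. f z)"
    using finite_terminals finite_actions
    by (intro sum.UNION_disjoint) (auto simp: prefix_def)
  finally show ?thesis .
qed

text \<open>Probability flow is conserved: the mass at \<open>h\<close> splits among its successors,
  whose action probabilities sum to 1. The induction is on the number of states extending
  \<open>h\<close>, which drops because \<open>h\<close> itself is lost on passing to a
  successor.\<close>

lemma sum_reach_terminals:
  assumes "h \<in> states G"
  shows "(\<Sum>z | z \<in> terminals G \<and> prefix h z. reach G \<sigma> z) = reach G \<sigma> h"
  using assms
proof (induction "card {h' \<in> states G. prefix h h'}" arbitrary: h rule: less_induct)
  case less
  show ?case
  proof (cases "h \<in> terminals G")
    case True
    then have "{z. z \<in> terminals G \<and> prefix h z} = {h}"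
      using terminal_iff[OF less.prems] terminals_subset
      by (auto) (metis strict_prefix_step empty_iff strict_prefix_def subsetD)
    then show ?thesis by simp
  next
    case False
    have "(\<Sum>z | z \<in> terminals G \<and> prefix (h @ [a]) z. reach G \<sigma> z) = reach G \<sigma> (h @ [a])"
      if "a \<in> actions G h" for a
    proof (rule less.hyps)
      show "h @ [a] \<in> states G" using that by (simp add: actions_def)
      have "h \<in> {h' \<in> states G. prefix h h'} - {h' \<in> states G. prefix (h @ [a]) h'}"
        using less.prems by (auto dest: prefix_length_le)
      then have "{h' \<in> states G. prefix (h @ [a]) h'} \<subset> {h' \<in> states G. prefix h h'}"
        by (blast dest: append_prefixD)
      then show "card {h' \<in> states G. prefix (h @ [a]) h'} < card {h' \<in> states G. prefix h h'}"
        using finite_states by (intro psubset_card_mono) auto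
    qed
    moreover have "{z. z \<in> terminals G \<and> prefix h z} = {z. z \<in> terminals G \<and> strict_prefix h z}"
      using False by (auto simp: strict_prefix_def)
    ultimately have "(\<Sum>z | z \<in> terminals G \<and> prefix h z. reach G \<sigma> z) =
        reach G \<sigma> h * (\<Sum>a\<in>actions G h. action_prob G \<sigma> h a)"
      by (simp add: sum_terminals_strict_prefix reach_snoc sum_distrib_left)
    then show ?thesis
      using sum_action_prob[of h "actions G h"] finite_actions less.prems False by simp
  qed
qed

end

section \<open>The team with known strategies against its opponents\<close>

locale team_game = played_game G \<sigma>
  for G :: "('a, 'p) efg" and \<sigma> :: "'p \<Rightarrow> 'a list set \<Rightarrow> 'a \<Rightarrow> real" +
  fixes Pa :: "'p set"
  assumes team_subset: "Pa \<subseteq> players G \<union> {chance G}" and chance_in_team: "chance G \<in> Pa"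
begin

abbreviation opponent_reach :: "'a list \<Rightarrow> real" where
  "opponent_reach \<equiv> team_reach G \<sigma> (players G - Pa)"

lemma finite_team: "finite Pa"
  using team_subset finite_players by (meson finite.intros finite_UnI finite_subset)

lemma reach_eq: "h \<in> states G \<Longrightarrow> reach G \<sigma> h = team_reach G \<sigma> Pa h * opponent_reach h"
  using finite_team finite_players team_subset chance_in_team
  by (intro reach_eq_team_reach_mult) auto

text \<open>The condition for all strategies is instantiated with the actual profile and multiplied
  over the opponents.\<close>

lemma opponent_reach_eq: "same_opponent_reach G Pa h h' \<Longrightarrow> opponent_reach h = opponent_reach h'"
  using strategies by (auto simp: same_opponent_reach_def team_reach_def intro!: prod.cong)

text \<open>On a part \<open>W\<close> the weights \<open>reach\<close> are a constant multiple of
  the team weights, so replacing \<open>v\<close> by its team-weighted mean leaves the sum over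
  \<open>W\<close> unchanged.\<close>

lemma expectation_base:
  assumes "matching_partition G Pa \<H> \<W>"
  shows "(\<Sum>z\<in>terminals G. reach G \<sigma> z *
      ((\<Sum>z'\<in>part_of \<W> z. team_reach G \<sigma> Pa z' * v z') /
       (\<Sum>z'\<in>part_of \<W> z. team_reach G \<sigma> Pa z'))) =
    (\<Sum>z\<in>terminals G. reach G \<sigma> z * v z)"
proof -
  have W: "partition_on (terminals G) \<W>"
    using assms by (simp add: matching_partition_def)
  have "(\<Sum>z\<in>W. reach G \<sigma> z *
      ((\<Sum>z'\<in>part_of \<W> z. team_reach G \<sigma> Pa z' * v z') /
       (\<Sum>z'\<in>part_of \<W> z. team_reach G \<sigma> Pa z'))) =
    (\<Sum>z\<in>W. reach G \<sigma> z * v z)" if "W \<in> \<W>" for W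
  proof -
    have sub: "W \<subseteq> terminals G" using W that by (auto simp: partition_on_def)
    then have fin: "finite W" using finite_terminals finite_subset by blast
    have "W \<noteq> {}" using W that by (auto simp: partition_on_def)
    then obtain w where w: "w \<in> W" by blast
    \<comment> \<open>\<open>w\<close> is an arbitrary representative at which the opponents' factor
      is frozen.\<close>
    have r: "reach G \<sigma> z = opponent_reach w * team_reach G \<sigma> Pa z" if "z \<in> W" for z
    proof -
      have "opponent_reach z = opponent_reach w"
        using assms that \<open>W \<in> \<W>\<close> w by (intro opponent_reach_eq) (auto simp: matching_partition_def)
      then show ?thesis using reach_eq that sub terminals_subset by auto
    qed
    define m where "m = team_reach G \<sigma> Pa"
    have "(\<Sum>z\<in>W. reach G \<sigma> z *
        ((\<Sum>z'\<in>part_of \<W> z. m z' * v z') / (\<Sum>z'\<in>part_of \<W> z. m z'))) =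
      (\<Sum>z\<in>W. opponent_reach w * (m z * ((\<Sum>z'\<in>W. m z' * v z') / (\<Sum>z'\<in>W. m z'))))"
      using part_of_eq[OF W that] r by (intro sum.cong) (simp_all add: m_def mult.assoc)
    also have "\<dots> = opponent_reach w * ((\<Sum>z\<in>W. m z) * ((\<Sum>z'\<in>W. m z' * v z') / (\<Sum>z'\<in>W. m z')))"
      by (simp only: sum_distrib_left sum_distrib_right)
    also have "\<dots> = opponent_reach w * (\<Sum>z\<in>W. m z * v z)"
      using sub terminals_subset team_reach_nonneg finite_team
      by (subst sum_weighted_average[OF fin]) (auto simp: m_def)
    also have "\<dots> = (\<Sum>z\<in>W. reach G \<sigma> z * v z)"
      using r by (auto simp: sum_distrib_left m_def mult.assoc intro!: sum.cong)
    finally show ?thesis unfolding m_def .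
  qed
  then show ?thesis
    by (simp add: sum_partition_on[OF finite_terminals W])
qed

section \<open>Correction terms have mean zero\<close>

lemma expectation_correction:
  assumes adm: "admissible_partition G Pa \<H>" and H: "H \<in> \<H>"
  shows "(\<Sum>z\<in>terminals G. reach G \<sigma> z * correction G \<sigma> Pa u H z) = 0"
proof -
  define m where "m = team_reach G \<sigma> Pa"
  define N where "N = (\<lambda>a. \<Sum>h\<in>H. m (h @ [a]) * u h a)"
  define M where "M = (\<lambda>a. \<Sum>h\<in>H. m (h @ [a]))"
  define D where "D = (\<Sum>h\<in>H. m h)"
  define A where "A = part_actions G H"
  \<comment> \<open>\<open>K a\<close> is the correction at any terminal state through
    \<open>H\<close> whose observed action is \<open>a\<close>; \<open>N a / M a\<close> is the mean
    of \<open>u h a\<close> over \<open>H\<close> with weights \<open>m (h @ [a])\<close>.\<close>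
  define K where "K = (\<lambda>a. (\<Sum>a\<in>A. N a) / D - N a / M a)"
  have sub: "H \<subseteq> decision_states G Pa"
    using adm H by (auto simp: admissible_partition_def partition_on_def)
  then have nonterm: "h \<in> states G - terminals G" and team: "actor G h \<in> Pa" if "h \<in> H" for h
    using that by (auto simp: decision_states_def)
  have anti: "\<not> strict_prefix h h'" if "h \<in> H" "h' \<in> H" for h h'
    using adm H that by (auto simp: admissible_partition_def)
  have "H \<subseteq> states G" using nonterm by blast
  then have finH: "finite H" using finite_states finite_subset by blast
  then have finA: "finite A" by (simp add: A_def part_actions_def finite_actions)
  have actA: "actions G h \<subseteq> A" if "h \<in> H" for h
    using that by (auto simp: A_def part_actions_def)
  have H_ne: "H \<noteq> {}" using adm H by (auto simp: admissible_partition_def partition_on_def)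
  then obtain h0 where h0: "h0 \<in> H" by blast
  have opp: "opponent_reach h = opponent_reach h0" if "h \<in> H" for h
    using adm H h0 that by (intro opponent_reach_eq) (auto simp: admissible_partition_def)
  have m_snoc: "m (h @ [a]) = m h * action_prob G \<sigma> h a" if "h \<in> H" for h a
    using team[OF that] finite_team by (simp add: m_def team_reach_snoc)
  have m_nonneg: "0 \<le> m h" if "h \<in> H" for h
    using nonterm[OF that] team_reach_nonneg finite_team by (simp add: m_def)
  have m_snoc_nonneg: "0 \<le> m (h @ [a])" if "h \<in> H" for h a
    using that m_snoc m_nonneg action_prob_nonneg nonterm by simp
  \<comment> \<open>For \<open>a\<close> in \<open>A\<close>, \<open>h @ [a]\<close> need not be a
    state, so the factorization is applied at \<open>h\<close>; the team acts there, hence the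
    action only changes \<open>m\<close>.\<close>
  have reach_snoc_eq: "reach G \<sigma> (h @ [a]) = opponent_reach h0 * m (h @ [a])" if "h \<in> H" for h a
    using reach_eq[of h] nonterm[OF that] m_snoc[OF that] opp[OF that]
    by (simp add: reach_snoc m_def)

  have corr: "correction G \<sigma> Pa u H z = K a"
    if "h \<in> H" "a \<in> actions G h" "prefix (h @ [a]) z" for h a z
  proof -
    have "strict_prefix h z"
      using that(3) by (auto simp: prefix_def strict_prefix_def)
    moreover have "observed_action G H z = a"
      using anti that by (rule observed_action_eq)
    ultimately show ?thesis
      using that(1) by (auto simp: correction_def K_def N_def M_def D_def A_def m_def)
  qed

  \<comment> \<open>Terminal states that miss \<open>H\<close> have correction 0 by
    definition.\<close>
  have "(\<Sum>z\<in>terminals G. reach G \<sigma> z * correction G \<sigma> Pa u H z) =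
      (\<Sum>z\<in>(\<Union>h\<in>H. {z. z \<in> terminals G \<and> strict_prefix h z}).
         reach G \<sigma> z * correction G \<sigma> Pa u H z)"
    using finite_terminals by (intro sum.mono_neutral_right) (auto simp: correction_def)
  also have "\<dots> = (\<Sum>h\<in>H. \<Sum>z | z \<in> terminals G \<and> strict_prefix h z.
      reach G \<sigma> z * correction G \<sigma> Pa u H z)"
  proof (rule sum.UNION_disjoint[OF finH])
    show "\<forall>h\<in>H. finite {z. z \<in> terminals G \<and> strict_prefix h z}"
      using finite_terminals by simp
    have "h = h'" if "h \<in> H" "h' \<in> H" "strict_prefix h z" "strict_prefix h' z" for h h' z
      using that anti prefix_same_cases[of h z h'] by (metis strict_prefix_def)
    then show "\<forall>h\<in>H. \<forall>h'\<in>H. h \<noteq> h' \<longrightarrow> {z. z \<in> terminals G \<and> strict_prefix h z} \<inter>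
        {z. z \<in> terminals G \<and> strict_prefix h' z} = {}"
      by blast
  qed
  \<comment> \<open>Once \<open>h\<close> and the next action are fixed, the correction no longer
    depends on \<open>z\<close>, so the inner sum can be collapsed by conservation of flow.\<close>
  also have "\<dots> = (\<Sum>h\<in>H. \<Sum>a\<in>actions G h. \<Sum>z | z \<in> terminals G \<and> prefix (h @ [a]) z.
      reach G \<sigma> z * K a)"
    unfolding sum_terminals_strict_prefix by (intro sum.cong refl) (auto simp: corr)
  also have "\<dots> = (\<Sum>h\<in>H. \<Sum>a\<in>actions G h. reach G \<sigma> (h @ [a]) * K a)"
    by (intro sum.cong refl)
      (simp add: sum_distrib_right[symmetric] sum_reach_terminals actions_def)
  \<comment> \<open>Padding with actions of probability 0 makes the inner range independent of
    \<open>h\<close>, so that the two sums can be swapped.\<close>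
  also have "\<dots> = (\<Sum>h\<in>H. \<Sum>a\<in>A. reach G \<sigma> (h @ [a]) * K a)"
    using finA actA
    by (intro sum.cong refl sum.mono_neutral_left) (auto simp: reach_snoc action_prob_def)
  also have "\<dots> = (\<Sum>h\<in>H. \<Sum>a\<in>A. opponent_reach h0 * (m (h @ [a]) * K a))"
    by (intro sum.cong refl) (simp add: reach_snoc_eq mult.assoc)
  also have "\<dots> = opponent_reach h0 * (\<Sum>a\<in>A. M a * K a)"
    by (subst sum.swap) (simp add: M_def sum_distrib_left sum_distrib_right)
  also have "(\<Sum>a\<in>A. M a * K a) = 0"
  proof -
    \<comment> \<open>If \<open>M a\<close> vanishes, so does every weight in
      \<open>N a\<close>.\<close>
    have MN: "M a * (N a / M a) = N a" for a
      unfolding M_def N_def using finH m_snoc_nonneg by (intro sum_weighted_average) auto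
    have sumM: "(\<Sum>a\<in>A. M a) = D"
    proof -
      have "(\<Sum>a\<in>A. M a) = (\<Sum>h\<in>H. m h * (\<Sum>a\<in>A. action_prob G \<sigma> h a))"
        unfolding M_def by (subst sum.swap) (simp add: m_snoc sum_distrib_left)
      then show ?thesis using sum_action_prob nonterm actA finA by (simp add: D_def)
    qed
    \<comment> \<open>This exhibits the numerator of the first quotient as a sum with the weights
      \<open>m h\<close> that make up \<open>D\<close>, so it cancels against \<open>D\<close> even
      when \<open>D\<close> is 0.\<close>
    have sumN: "(\<Sum>a\<in>A. N a) = (\<Sum>h\<in>H. m h * (\<Sum>a\<in>A. action_prob G \<sigma> h a * u h a))"
      unfolding N_def by (subst sum.swap) (simp add: m_snoc sum_distrib_left mult.assoc)
    have "(\<Sum>a\<in>A. M a * K a) = (\<Sum>a\<in>A. M a * ((\<Sum>a\<in>A. N a) / D) - N a)"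
      by (simp add: K_def right_diff_distrib MN del: times_divide_eq_right)
    also have "\<dots> = D * ((\<Sum>a\<in>A. N a) / D) - (\<Sum>a\<in>A. N a)"
      by (simp only: sum_subtractf sum_distrib_right[symmetric] sumM)
    also have "D * ((\<Sum>a\<in>A. N a) / D) = (\<Sum>a\<in>A. N a)"
      unfolding sumN D_def using finH m_nonneg by (rule sum_weighted_average)
    finally show ?thesis by simp
  qed
  finally show ?thesis by simp
qed

end

theorem mainTheorem1:
  fixes G :: "('a, 'p) efg"
    and \<sigma> :: "'p \<Rightarrow> 'a list set \<Rightarrow> 'a \<Rightarrow> real"
    and Pa :: "'p set"
    and \<H> \<W> :: "'a list set set"
    and u :: "'a list \<Rightarrow> 'a \<Rightarrow> real"
    and p :: 'p
  assumes "extensive_game G"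
    and "\<And>q. q \<in> players G \<Longrightarrow> behaviour_strategy G q (\<sigma> q)"
    and "Pa \<subseteq> players G \<union> {chance G}" and "chance G \<in> Pa"
    and "admissible_partition G Pa \<H>"
    and "matching_partition G Pa \<H> \<W>"
    and "p \<in> players G"
  shows "(\<Sum>z\<in>terminals G. reach G \<sigma> z * aivat G \<sigma> Pa \<H> \<W> u p z) =
         (\<Sum>z\<in>terminals G. reach G \<sigma> z * payoff G p z)"
proof -
  interpret team_game G \<sigma> Pa
    using assms by unfold_locales
  have "(\<Sum>z\<in>terminals G. reach G \<sigma> z * (\<Sum>H\<in>\<H>. correction G \<sigma> Pa u H z)) =
      (\<Sum>H\<in>\<H>. \<Sum>z\<in>terminals G. reach G \<sigma> z * correction G \<sigma> Pa u H z)"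
    by (subst sum.swap) (simp add: sum_distrib_left)
  also have "\<dots> = 0"
    using expectation_correction[OF assms(5)] by simp
  \<comment> \<open>Removing \<open>times_divide_eq_right\<close> keeps the product with the
    quotient in the shape of \<open>expectation_base\<close>.\<close>
  finally show ?thesis
    by (simp add: aivat_def distrib_left sum.distrib expectation_base[OF assms(6)]
        del: times_divide_eq_right)
qed

end
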